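(* Consider a two-agent constrained dynamic game (a dyadic interaction, $\mathcal{N}=\{1,2\}$) whose stage-wise costs are $$L^1_k(x_k,u_k)=L^{11}_k(x^1_k,u^1_k)+c^1_kL^{12}_k(x^1_k,x^2_k),\qquad L^2_k(x_k,u_k)=L^{22}_k(x^2_k,u^2_k)+c^2_kL^{21}_k(x^2_k,x^1_k)$$ for $0\le k\le T-1$, and whose terminal costs are $$L^1_T(x_T)=L^{11}_T(x^1_T)+c^1_TL^{12}_T(x^1_T,x^2_T),\qquad L^2_T(x_T)=L^{22}_T(x^2_T)+c^2_TL^{21}_T(x^2_T,x^1_T),$$ where $c^1_k>0$ and $c^2_k>0$ for all $k\in\{0,1,\ldots,T\}$. Assume that for every time step $1\le k\le T$, $L^{12}_k(x^1_k,x^2_k)=L^{21}_k(x^2_k,x^1_k)$ for every pair of states $(x^1_k,x^2_k)$. Then the game is a WCPDG with weights $w^1_k=\frac{1}{c^2_k}$ and $w^2_k=\frac{1}{c^1_k}$ ($0\le k\le T$). Furthermore, a corresponding potential function is $P(x,u)=L_T(x_T)+\sum_{k=0}^{T-1}L_k(x_k,u_k)$, where $$L_k(x_k,u_k)=c^2_kL^{11}_k(x^1_k,u^1_k)+c^1_kL^{22}_k(x^2_k,u^2_k)+c^1_kc^2_kL^{12}_k(x^1_k,x^2_k),$$ $$L_T(x_T)=c^2_TL^{11}_T(x^1_T)+c^1_TL^{22}_T(x^2_T)+c^1_Tc^2_TL^{12}_T(x^1_T,x^2_T).$$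
   Context: Setting. $\mathcal{N}=\{1,\ldots,N\}$ is the set of agents and $T$ is a finite horizon. Agent $i$ has state space $\mathcal{X}^i\subseteq\mathbb{R}^{n_i}$ and action space $\mathcal{U}^i\subseteq\mathbb{R}^{m_i}$; $\mathcal{X}=\prod_i\mathcal{X}^i$, $\mathcal{U}=\prod_i\mathcal{U}^i$. The joint state and action at time $k$ are $x_k=(x^1_k,\ldots,x^N_k)$ and $u_k=(u^1_k,\ldots,u^N_k)$; $x=\{x_k\}_{k=0}^{T}$, $u=\{u_k\}_{k=0}^{T-1}$. A superscript $-i$ denotes the tuple of components of all agents except $i$; the superscripts on $c^i_k$ and $L^{ij}_k$ are indices, not powers. The game is $\mathcal{G}=( \mathcal{N}, \{\Gamma^i\}, \{J^i\},\{\mathcal{C}_k\},f,x_0 )$ with fixed initial state $x_0$. Each agent has separate dynamics $x^i_{k+1}=f^i(x^i_k,u^i_k)$; jointly $x_{k+1}=f(x_k,u_k)$ with $f=(f^1,\ldots,f^N)$. The shared inequality constraints are $g(x_k,u_k)\le 0$ (elementwise, $g:\mathcal{X}\times\mathcal{U}\to\mathbb{R}^c$) for $0\le k\le T-1$ and $g(x_T)\le 0$ at the terminal time (a function of the terminal state only). $\mathcal{C}_k$ is the set of feasible pairs $(x_k,u_k)$ at time $k\le T-1$ (in $\mathcal{X}\times\mathcal{U}$, consistent with the dynamics, satisfying $g(x_k,u_k)\le0$), and $\mathcal{C}_T=\{x_T\in\mathcal{X}: g(x_T)\le 0\}$. Costs. Agent $i$ minimizes $J^i(x,u)=L^i_T(x_T)+\sum_{k=0}^{T-1}L^i_k(x_k,u_k)$.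 Strategies. An open-loop strategy of agent $i$ is $\gamma^i=\{\gamma^i_k\}_{k=0}^{T-1}$, determined by $x_0$ and time, $u^i_k=\gamma^i(x_0,k)$; for given $x_0$ it is identified with the action sequence of agent $i$. $\Gamma^i$ is the strategy space of agent $i$, $\Gamma=\prod_i\Gamma^i$. A joint strategy $\gamma$ is feasible if the state-action trajectory $(x,u)$ it generates from $x_0$ satisfies $(x_k,u_k)\in\mathcal{C}_k$ for $0\le k\le T-1$ and $x_T\in\mathcal{C}_T$; such $(x,u)$ is called a feasible system trajectory. WCPDG. $\mathcal{G}$ is a weighted constrained potential dynamic game (WCPDG) with positive weights $w=(w^i_k)_{i\in\mathcal{N},\,0\le k\le T}$ if there exists a potential functional $P(x,u)=L_T(x_T)+\sum_{k=0}^{T-1}L_k(x_k,u_k)$ such that for every agent $i$, all strategies $\gamma^i,\nu^i\in\Gamma^i$ and $\gamma^{-i}\in\Gamma^{-i}$ with $(\gamma^i,\gamma^{-i})$ and $(\nu^i,\gamma^{-i})$ feasible, $$J^i(x,u)-J^i(x',u')=w^i_T\big(L_T(x_T)-L_T(x'_T)\big)+\sum_{k=0}^{T-1}w^i_k\big(L_k(x_k,u_k)-L_k(x'_k,u'_k)\big),$$ where $(x,u)$ and $(x',u')$ are the feasible system trajectories generated by $(\gamma^i,\gamma^{-i})$ and $(\nu^i,\gamma^{-i})$, respectively (both starting from $x_0$). Standing assumptions. The costs $L^i_k$ and $L^i_T$ are continuously differentiable on $\mathcal{X}\times\mathcal{U}$ and $\mathcal{X}$, respectively. The dynamics $f$ and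 constraints $g$ are continuously differentiable on $\mathcal{X}\times\mathcal{U}$ and satisfy some regularity conditions (such as linear independence of gradients or the Mangasarian-Fromovitz constraint qualification). *)

theory Defs
  imports "HOL-Analysis.Analysis"
begin

text \<open>Continuous differentiability on a set that need not be open: there is a continuously
  differentiable extension to an open neighbourhood.\<close>

definition C1_on :: "('a::real_normed_vector \<Rightarrow> 'b::real_normed_vector) \<Rightarrow> 'a set \<Rightarrow> bool" where
  "C1_on h S \<longleftrightarrow>
     (\<exists>V H H'. open V \<and> S \<subseteq> V \<and> (\<forall>z\<in>S. H z = h z) \<and>
        (\<forall>z\<in>V. (H has_derivative blinfun_apply (H' z)) (at z)) \<and> continuous_on V H')"

text \<open>The agents are the elements of the finite type \<open>'i\<close>. The spaces of different agents may have
  different dimensions: agent \<open>i\<close> lives in the coordinate subspace of an ambient space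
  \<open>real ^ 'n\<close> (\<open>real ^ 'm\<close> for actions) that is spanned by the coordinates in a set depending on
  \<open>i\<close>, so that \<open>n\<^sub>i = card (state_coords G i)\<close> and \<open>m\<^sub>i = card (action_coords G i)\<close>.\<close>

definition coord_subspace :: "'n set \<Rightarrow> (real ^ 'n) set" where
  "coord_subspace D = {v. \<forall>j. j \<notin> D \<longrightarrow> v $ j = 0}"

text \<open>Joint states have type \<open>(real ^ 'n) ^ 'i\<close> and joint actions \<open>(real ^ 'm) ^ 'i\<close>. Since the
  initial state is fixed, an open-loop strategy of agent \<open>i\<close> is identified with an action sequence
  \<open>nat \<Rightarrow> real ^ 'm\<close>, of which only the entries before the horizon matter.\<close>

record ('i::finite, 'n::finite, 'm::finite, 'c::finite, 'd::finite) dynamic_game =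
  horizon :: nat
  state_coords :: "'i \<Rightarrow> 'n set"
  action_coords :: "'i \<Rightarrow> 'm set"
  state_space :: "'i \<Rightarrow> (real ^ 'n) set"
  action_space :: "'i \<Rightarrow> (real ^ 'm) set"
  strategy_space :: "'i \<Rightarrow> (nat \<Rightarrow> real ^ 'm) set"
  agent_dynamics :: "'i \<Rightarrow> real ^ 'n \<Rightarrow> real ^ 'm \<Rightarrow> real ^ 'n"
  stage_constraint :: "(real ^ 'n) ^ 'i \<Rightarrow> (real ^ 'm) ^ 'i \<Rightarrow> real ^ 'c"
  terminal_constraint :: "(real ^ 'n) ^ 'i \<Rightarrow> real ^ 'd"
  stage_cost :: "'i \<Rightarrow> nat \<Rightarrow> (real ^ 'n) ^ 'i \<Rightarrow> (real ^ 'm) ^ 'i \<Rightarrow> real"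
  terminal_cost :: "'i \<Rightarrow> (real ^ 'n) ^ 'i \<Rightarrow> real"
  initial_state :: "(real ^ 'n) ^ 'i"

definition joint_states ::
  "('i::finite, 'n::finite, 'm::finite, 'c::finite, 'd::finite) dynamic_game \<Rightarrow> ((real ^ 'n) ^ 'i) set"
  where "joint_states G = {x. \<forall>i. x $ i \<in> state_space G i}"

definition joint_actions ::
  "('i::finite, 'n::finite, 'm::finite, 'c::finite, 'd::finite) dynamic_game \<Rightarrow> ((real ^ 'm) ^ 'i) set"
  where "joint_actions G = {u. \<forall>i. u $ i \<in> action_space G i}"

definition dynamics ::
  "('i::finite, 'n::finite, 'm::finite, 'c::finite, 'd::finite) dynamic_game
     \<Rightarrow> (real ^ 'n) ^ 'i \<Rightarrow> (real ^ 'm) ^ 'i \<Rightarrow> (real ^ 'n) ^ 'i"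
  where "dynamics G x u = (\<chi> i. agent_dynamics G i (x $ i) (u $ i))"

text \<open>Smoothness is required on the joint spaces only. No constraint qualification is imposed on
  the dynamics and constraints, so statements about all such games cover in particular those
  satisfying linear independence of gradients, Mangasarian-Fromovitz, etc.\<close>

definition smooth_game ::
  "('i::finite, 'n::finite, 'm::finite, 'c::finite, 'd::finite) dynamic_game \<Rightarrow> bool"
  where "smooth_game G \<longleftrightarrow>
    (\<forall>i. state_space G i \<subseteq> coord_subspace (state_coords G i)) \<and>
    (\<forall>i. action_space G i \<subseteq> coord_subspace (action_coords G i)) \<and>
    (\<forall>i. \<forall>\<gamma>\<in>strategy_space G i. \<forall>k<horizon G. \<gamma> k \<in> action_space G i) \<and>
    (\<forall>i. \<forall>a\<in>state_space G i. \<forall>b\<in>action_space G i.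
       agent_dynamics G i a b \<in> coord_subspace (state_coords G i)) \<and>
    initial_state G \<in> joint_states G \<and>
    (\<forall>i. \<forall>k<horizon G.
       C1_on (\<lambda>(x, u). stage_cost G i k x u) (joint_states G \<times> joint_actions G)) \<and>
    (\<forall>i. C1_on (terminal_cost G i) (joint_states G)) \<and>
    C1_on (\<lambda>(x, u). dynamics G x u) (joint_states G \<times> joint_actions G) \<and>
    C1_on (\<lambda>(x, u). stage_constraint G x u) (joint_states G \<times> joint_actions G) \<and>
    C1_on (terminal_constraint G) (joint_states G)"

text \<open>The order on \<open>real ^ 'c\<close> is componentwise. For a single pair \<open>(x, u)\<close>, consistency with the
  dynamics means that the successor state is again in the state space.\<close>

definition stage_feasible ::
  "('i::finite, 'n::finite, 'm::finite, 'c::finite, 'd::finite) dynamic_game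
     \<Rightarrow> (((real ^ 'n) ^ 'i) \<times> ((real ^ 'm) ^ 'i)) set"
  where "stage_feasible G =
    {(x, u). x \<in> joint_states G \<and> u \<in> joint_actions G \<and>
       dynamics G x u \<in> joint_states G \<and> stage_constraint G x u \<le> 0}"

definition terminal_feasible ::
  "('i::finite, 'n::finite, 'm::finite, 'c::finite, 'd::finite) dynamic_game \<Rightarrow> ((real ^ 'n) ^ 'i) set"
  where "terminal_feasible G = {x \<in> joint_states G. terminal_constraint G x \<le> 0}"

definition action_traj :: "('i::finite \<Rightarrow> nat \<Rightarrow> real ^ 'm) \<Rightarrow> nat \<Rightarrow> (real ^ 'm) ^ 'i" where
  "action_traj \<gamma> k = (\<chi> i. \<gamma> i k)"

primrec state_traj ::
  "('i::finite, 'n::finite, 'm::finite, 'c::finite, 'd::finite) dynamic_game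
     \<Rightarrow> ('i \<Rightarrow> nat \<Rightarrow> real ^ 'm) \<Rightarrow> nat \<Rightarrow> (real ^ 'n) ^ 'i"
  where
    "state_traj G \<gamma> 0 = initial_state G"
  | "state_traj G \<gamma> (Suc k) = dynamics G (state_traj G \<gamma> k) (action_traj \<gamma> k)"

definition feasible ::
  "('i::finite, 'n::finite, 'm::finite, 'c::finite, 'd::finite) dynamic_game
     \<Rightarrow> ('i \<Rightarrow> nat \<Rightarrow> real ^ 'm) \<Rightarrow> bool"
  where "feasible G \<gamma> \<longleftrightarrow>
    (\<forall>k<horizon G. (state_traj G \<gamma> k, action_traj \<gamma> k) \<in> stage_feasible G) \<and>
    state_traj G \<gamma> (horizon G) \<in> terminal_feasible G"

definition total_cost ::
  "('i::finite, 'n::finite, 'm::finite, 'c::finite, 'd::finite) dynamic_game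
     \<Rightarrow> 'i \<Rightarrow> (nat \<Rightarrow> (real ^ 'n) ^ 'i) \<Rightarrow> (nat \<Rightarrow> (real ^ 'm) ^ 'i) \<Rightarrow> real"
  where "total_cost G i x u =
    terminal_cost G i (x (horizon G)) + (\<Sum>k<horizon G. stage_cost G i k (x k) (u k))"

text \<open>The functional \<open>P\<close> is a potential for the weights \<open>w\<close>, through the decomposition of \<open>P\<close> into
  the stage terms \<open>L k\<close> and the terminal term \<open>Lterm\<close>. The decomposition is a parameter because the
  weights are attached to its individual terms. The profile in which agent \<open>i\<close> deviates from
  \<open>\<gamma>\<close> to \<open>\<nu>\<close> is \<open>\<gamma>(i := \<nu>)\<close>.\<close>

definition weighted_potential ::
  "('i::finite, 'n::finite, 'm::finite, 'c::finite, 'd::finite) dynamic_game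
     \<Rightarrow> ('i \<Rightarrow> nat \<Rightarrow> real)
     \<Rightarrow> ((nat \<Rightarrow> (real ^ 'n) ^ 'i) \<Rightarrow> (nat \<Rightarrow> (real ^ 'm) ^ 'i) \<Rightarrow> real)
     \<Rightarrow> (nat \<Rightarrow> (real ^ 'n) ^ 'i \<Rightarrow> (real ^ 'm) ^ 'i \<Rightarrow> real)
     \<Rightarrow> ((real ^ 'n) ^ 'i \<Rightarrow> real) \<Rightarrow> bool"
  where "weighted_potential G w P L Lterm \<longleftrightarrow>
    (\<forall>x u. P x u = Lterm (x (horizon G)) + (\<Sum>k<horizon G. L k (x k) (u k))) \<and>
    (\<forall>i \<gamma> \<nu>. (\<forall>j. \<gamma> j \<in> strategy_space G j) \<longrightarrow> \<nu> \<in> strategy_space G i \<longrightarrow>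
       feasible G \<gamma> \<longrightarrow> feasible G (\<gamma>(i := \<nu>)) \<longrightarrow>
       (let x = state_traj G \<gamma>; u = action_traj \<gamma>;
            x' = state_traj G (\<gamma>(i := \<nu>)); u' = action_traj (\<gamma>(i := \<nu>))
        in total_cost G i x u - total_cost G i x' u' =
             w i (horizon G) * (Lterm (x (horizon G)) - Lterm (x' (horizon G))) +
             (\<Sum>k<horizon G. w i k * (L k (x k) (u k) - L k (x' k) (u' k)))))"

definition WCPDG ::
  "('i::finite, 'n::finite, 'm::finite, 'c::finite, 'd::finite) dynamic_game
     \<Rightarrow> ('i \<Rightarrow> nat \<Rightarrow> real) \<Rightarrow> bool"
  where "WCPDG G w \<longleftrightarrow>
    (\<forall>i. \<forall>k\<le>horizon G. 0 < w i k) \<and> (\<exists>P L Lterm. weighted_potential G w P L Lterm)"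

end

theory Submission
  imports Defs
begin

text \<open>The dynamics are decoupled and strategies are open-loop, so when one agent deviates, the
  other agent's states and actions stay the same (\<open>state_traj_unilateral\<close>,
  \<open>action_traj_unilateral\<close>). In the difference of potential terms at a fixed time, the
  opponent's private cost therefore cancels. For agent 1 what is left is \<open>c 2 k\<close> times
  the change of L11 + c1 L12, and for agent 2 it is \<open>c 1 k\<close> times the change of L22 +
  c2 L12; the weights remove exactly these factors.

  For agent 1 this is already the change of cost. For agent 2, L12 must be traded for L21, and only
  their differences along two trajectories have to agree: this is the fact \<open>coupling\<close>.
  The identity holds time by time, and \<open>weighted_potentialI\<close> sums it.\<close>

lemma action_traj_unilateral:
  "j \<noteq> i \<Longrightarrow> action_traj (\<gamma>(i := \<nu>)) k $ j = action_traj \<gamma> k $ j"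
  by (simp add: action_traj_def)

text \<open>Component j of \<open>dynamics\<close> reads only component j of the state and of the
  action, so a deviation by agent i never reaches agent j.\<close>

lemma state_traj_unilateral:
  "j \<noteq> i \<Longrightarrow> state_traj G (\<gamma>(i := \<nu>)) k $ j = state_traj G \<gamma> k $ j"
  by (induction k) (simp_all add: dynamics_def action_traj_unilateral)

text \<open>The cost formulas are assumed only on the joint spaces, so they may be applied along a
  trajectory only after this membership is known. The final time is separate because it is governed
  by \<open>terminal_feasible\<close>.\<close>

lemma feasible_imp_joint_states:
  assumes "feasible G \<gamma>" "k \<le> horizon G"
  shows "state_traj G \<gamma> k \<in> joint_states G"
  using assms by (cases "k = horizon G")
    (auto simp: feasible_def stage_feasible_def terminal_feasible_def)

lemma feasible_imp_joint_actions:
  assumes "feasible G \<gamma>" "k < horizon G"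
  shows "action_traj \<gamma> k \<in> joint_actions G"
  using assms by (auto simp: feasible_def stage_feasible_def)

text \<open>Both sides of the defining identity are sums over time, so matching them term by term
  suffices.\<close>

lemma weighted_potentialI:
  fixes G :: "('i::finite, 'n::finite, 'm::finite, 'c::finite, 'd::finite) dynamic_game"
  assumes "\<And>x u. P x u = Lterm (x (horizon G)) + (\<Sum>k<horizon G. L k (x k) (u k))"
    and terminal: "\<And>i \<gamma> \<nu>. feasible G \<gamma> \<Longrightarrow> feasible G (\<gamma>(i := \<nu>)) \<Longrightarrow>
      terminal_cost G i (state_traj G \<gamma> (horizon G))
        - terminal_cost G i (state_traj G (\<gamma>(i := \<nu>)) (horizon G)) =
      w i (horizon G) * (Lterm (state_traj G \<gamma> (horizon G))
        - Lterm (state_traj G (\<gamma>(i := \<nu>)) (horizon G)))"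
    and stage: "\<And>i \<gamma> \<nu> k. feasible G \<gamma> \<Longrightarrow> feasible G (\<gamma>(i := \<nu>)) \<Longrightarrow> k < horizon G \<Longrightarrow>
      stage_cost G i k (state_traj G \<gamma> k) (action_traj \<gamma> k)
        - stage_cost G i k (state_traj G (\<gamma>(i := \<nu>)) k) (action_traj (\<gamma>(i := \<nu>)) k) =
      w i k * (L k (state_traj G \<gamma> k) (action_traj \<gamma> k)
        - L k (state_traj G (\<gamma>(i := \<nu>)) k) (action_traj (\<gamma>(i := \<nu>)) k))"
  shows "weighted_potential G w P L Lterm"
proof -
  have "total_cost G i (state_traj G \<gamma>) (action_traj \<gamma>)
      - total_cost G i (state_traj G (\<gamma>(i := \<nu>))) (action_traj (\<gamma>(i := \<nu>))) =
    w i (horizon G) * (Lterm (state_traj G \<gamma> (horizon G))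
        - Lterm (state_traj G (\<gamma>(i := \<nu>)) (horizon G))) +
    (\<Sum>k<horizon G. w i k * (L k (state_traj G \<gamma> k) (action_traj \<gamma> k)
        - L k (state_traj G (\<gamma>(i := \<nu>)) k) (action_traj (\<gamma>(i := \<nu>)) k)))"
    if "feasible G \<gamma>" "feasible G (\<gamma>(i := \<nu>))" for i \<gamma> \<nu>
    by (simp add: total_cost_def terminal[OF that, symmetric] stage[OF that, symmetric]
        sum_subtractf)
  with assms(1) show ?thesis
    unfolding weighted_potential_def Let_def by blast
qed

theorem lemma3:
  fixes G :: "(2, 'n::finite, 'm::finite, 'c::finite, 'd::finite) dynamic_game"
    and c :: "2 \<Rightarrow> nat \<Rightarrow> real"
    and L11 L22 :: "nat \<Rightarrow> real ^ 'n \<Rightarrow> real ^ 'm \<Rightarrow> real"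
    and L11T L22T :: "real ^ 'n \<Rightarrow> real"
    and L12 L21 :: "nat \<Rightarrow> real ^ 'n \<Rightarrow> real ^ 'n \<Rightarrow> real"
  defines "w \<equiv> (\<lambda>i k. if i = 1 then 1 / c 2 k else 1 / c 1 k)"
  defines "L \<equiv> (\<lambda>k x u. c 2 k * L11 k (x $ 1) (u $ 1) + c 1 k * L22 k (x $ 2) (u $ 2)
                       + c 1 k * c 2 k * L12 k (x $ 1) (x $ 2))"
  defines "Lterm \<equiv> (\<lambda>x. c 2 (horizon G) * L11T (x $ 1) + c 1 (horizon G) * L22T (x $ 2)
                       + c 1 (horizon G) * c 2 (horizon G) * L12 (horizon G) (x $ 1) (x $ 2))"
  defines "P \<equiv> (\<lambda>x u. Lterm (x (horizon G)) + (\<Sum>k<horizon G. L k (x k) (u k)))"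
  assumes "smooth_game G"
    and "\<forall>i. \<forall>k\<le>horizon G. 0 < c i k"
    and "\<forall>k<horizon G. \<forall>x\<in>joint_states G. \<forall>u\<in>joint_actions G.
           stage_cost G 1 k x u = L11 k (x $ 1) (u $ 1) + c 1 k * L12 k (x $ 1) (x $ 2)"
    and "\<forall>k<horizon G. \<forall>x\<in>joint_states G. \<forall>u\<in>joint_actions G.
           stage_cost G 2 k x u = L22 k (x $ 2) (u $ 2) + c 2 k * L21 k (x $ 2) (x $ 1)"
    and "\<forall>x\<in>joint_states G.
           terminal_cost G 1 x = L11T (x $ 1) + c 1 (horizon G) * L12 (horizon G) (x $ 1) (x $ 2)"
    and "\<forall>x\<in>joint_states G.
           terminal_cost G 2 x = L22T (x $ 2) + c 2 (horizon G) * L21 (horizon G) (x $ 2) (x $ 1)"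
    and "\<forall>k. 1 \<le> k \<longrightarrow> k \<le> horizon G \<longrightarrow>
           (\<forall>a\<in>state_space G 1. \<forall>b\<in>state_space G 2. L12 k a b = L21 k b a)"
  shows "WCPDG G w \<and> weighted_potential G w P L Lterm"
proof -
  note c_pos = assms(6) and stage_1 = assms(7) and stage_2 = assms(8)
    and terminal_1 = assms(9) and terminal_2 = assms(10) and symmetric = assms(11)
  note defs = w_def L_def Lterm_def
  have c_nz: "c i k \<noteq> 0" if "k \<le> horizon G" for i k
    using c_pos that by (metis less_irrefl)
  \<comment> \<open>Symmetry may fail at time 0, but there the state is fixed and both sides vanish.\<close>
  have coupling: "L21 k (state_traj G \<gamma> k $ 2) (state_traj G \<gamma> k $ 1)
        - L21 k (state_traj G \<gamma>' k $ 2) (state_traj G \<gamma>' k $ 1) =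
      L12 k (state_traj G \<gamma> k $ 1) (state_traj G \<gamma> k $ 2)
        - L12 k (state_traj G \<gamma>' k $ 1) (state_traj G \<gamma>' k $ 2)"
    if "feasible G \<gamma>" "feasible G \<gamma>'" "k \<le> horizon G" for \<gamma> \<gamma>' k
  proof (cases k)
    case 0
    then show ?thesis by simp
  next
    case (Suc n)
    then show ?thesis
      using symmetric that(3) feasible_imp_joint_states[OF that(1,3)]
        feasible_imp_joint_states[OF that(2,3)]
      by (simp add: joint_states_def)
  qed
  have "weighted_potential G w P L Lterm"
  proof (rule weighted_potentialI)
    show "P x u = Lterm (x (horizon G)) + (\<Sum>k<horizon G. L k (x k) (u k))" for x u
      by (simp add: P_def)
  next
    fix i \<gamma> \<nu>
    assume feas: "feasible G \<gamma>" "feasible G (\<gamma>(i := \<nu>))"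
    let ?T = "horizon G"
    let ?x = "state_traj G \<gamma> ?T" and ?y = "state_traj G (\<gamma>(i := \<nu>)) ?T"
    note mem = feas[THEN feasible_imp_joint_states, OF order_refl]
    consider "i = 1" | "i = 2"
      using exhaust_2 by blast
    then show "terminal_cost G i ?x - terminal_cost G i ?y = w i ?T * (Lterm ?x - Lterm ?y)"
    proof cases
      case 1
      \<comment> \<open>Hence \<open>L22T\<close> cancels, and the weight \<open>1 / c 2 ?T\<close>
        absorbs the common factor of the remaining terms.\<close>
      have "?y $ 2 = ?x $ 2"
        using 1 by (simp add: state_traj_unilateral)
      then show ?thesis
        using 1 mem terminal_1 c_nz[of ?T] by (simp add: defs field_simps)
    next
      case 2
      have other: "?y $ 1 = ?x $ 1"
        using 2 by (simp add: state_traj_unilateral)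
      \<comment> \<open>The L21 terms are grouped into one difference so that
        \<open>coupling\<close> can rewrite it. This form also covers horizon 0, where the terminal
        time is time 0 and symmetry is not assumed.\<close>
      have diff: "terminal_cost G i ?x - terminal_cost G i ?y =
          L22T (?x $ 2) - L22T (?y $ 2)
            + c 2 ?T * (L21 ?T (?x $ 2) (?x $ 1) - L21 ?T (?y $ 2) (?y $ 1))"
        using 2 mem terminal_2 by (simp add: algebra_simps)
      show ?thesis
        unfolding diff coupling[OF feas order_refl]
        using 2 other c_nz[of ?T] by (simp add: defs field_simps)
    qed
  next
    fix i \<gamma> \<nu> k
    assume feas: "feasible G \<gamma>" "feasible G (\<gamma>(i := \<nu>))" and k: "k < horizon G"
    let ?x = "state_traj G \<gamma> k" and ?y = "state_traj G (\<gamma>(i := \<nu>)) k"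
    let ?u = "action_traj \<gamma> k" and ?v = "action_traj (\<gamma>(i := \<nu>)) k"
    note k_le = less_imp_le[OF k]
    note mem = feas[THEN feasible_imp_joint_states, OF k_le]
      feas[THEN feasible_imp_joint_actions, OF k]
    consider "i = 1" | "i = 2"
      using exhaust_2 by blast
    then show "stage_cost G i k ?x ?u - stage_cost G i k ?y ?v = w i k * (L k ?x ?u - L k ?y ?v)"
    proof cases
      case 1
      \<comment> \<open>Stage costs involve actions, so cancelling \<open>L22 k\<close> takes agent
        2's state and action both unchanged.\<close>
      have "?y $ 2 = ?x $ 2" "?v $ 2 = ?u $ 2"
        using 1 by (simp_all add: state_traj_unilateral action_traj_unilateral)
      then show ?thesis
        using 1 k mem stage_1 c_nz[OF k_le] by (simp add: defs field_simps)
    next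
      case 2
      have other: "?y $ 1 = ?x $ 1" "?v $ 1 = ?u $ 1"
        using 2 by (simp_all add: state_traj_unilateral action_traj_unilateral)
      \<comment> \<open>Grouped again for \<open>coupling\<close>, since at k = 0 the values of L21
        and L12 may differ although their changes agree.\<close>
      have diff: "stage_cost G i k ?x ?u - stage_cost G i k ?y ?v =
          L22 k (?x $ 2) (?u $ 2) - L22 k (?y $ 2) (?v $ 2)
            + c 2 k * (L21 k (?x $ 2) (?x $ 1) - L21 k (?y $ 2) (?y $ 1))"
        using 2 k mem stage_2 by (simp add: algebra_simps)
      show ?thesis
        unfolding diff coupling[OF feas k_le]
        using 2 other c_nz[OF k_le] by (simp add: defs field_simps)
    qed
  qed
  moreover have "\<forall>i. \<forall>k\<le>horizon G. 0 < w i k"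
    using c_pos by (simp add: w_def)
  ultimately show ?thesis
    unfolding WCPDG_def by blast
qed

end
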